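(* Let $H$ be a cyclic group of order $p_1p_2p_3$, where $p_1,p_2,p_3$ are distinct primes. Then $OD(H)$ is isomorphic to $$\Big(\big((G_1\diamond G_{12})\cup(G_{12}\diamond G_2)\cup(G_2\diamond G_{23})\cup(G_{23}\diamond G_3)\cup(G_3\diamond G_{13})\cup(G_{13}\diamond G_1)\big)\diamond G_{123}\Big)\diamond K_1,$$ where $G_i\cong(p_i-1)K_1$ for $1\leq i\leq 3$, $G_{12}\cong(p_1-1)(p_2-1)K_1$, $G_{23}\cong(p_2-1)(p_3-1)K_1$, $G_{13}\cong(p_1-1)(p_3-1)K_1$ and $G_{123}\cong(p_1-1)(p_2-1)(p_3-1)K_1$.
   Context: For a finite group $G$, the order divisor graph $OD(G)$ is the simple undirected graph with vertex set $G$ in which two distinct vertices $a,b$ are adjacent if and only if $o(a)\neq o(b)$ and either $o(a)\mid o(b)$ or $o(b)\mid o(a)$. $mK_1$ denotes the edgeless graph on $m$ vertices. For graphs $A,B$ on disjoint vertex sets, $A\diamond B$ (the join) is the graph on $V(A)\cup V(B)$ with all edges of $A$ and $B$ plus every edge joining a vertex of $A$ to a vertex of $B$. In the displayed expression, $G_1,G_2,G_3,G_{12},G_{23},G_{13},G_{123}$ are seven fixed graphs on pairwise disjoint vertex sets and $K_1$ is one further vertex; $\cup$ denotes the union of graphs (union of vertex sets and of edge sets, the same named graph contributing the same vertices each time it occurs). Hence the graph consists of the seven independent sets, with complete bipartite connections between $G_1$–$G_{12}$, $G_{12}$–$G_2$, $G_2$–$G_{23}$, $G_{23}$–$G_3$,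 $G_3$–$G_{13}$, $G_{13}$–$G_1$, between $G_{123}$ and each of the other six, and a vertex ($K_1$) adjacent to all other vertices. *)

theory Defs
  imports
    "HOL-Algebra.Elementary_Groups"
    "HOL-Algebra.Multiplicative_Group"
    "HOL-Computational_Algebra.Primes"
    "Graph_Theory.Pair_Digraph"
    "Graph_Theory.Digraph_Isomorphism"
begin

text \<open>
  A simple undirected graph is a symmetric, irreflexive pair digraph: an edge between
  \<open>a\<close> and \<open>b\<close> is the pair of arcs \<open>(a, b)\<close>, \<open>(b, a)\<close>. Isomorphism is \<^const>\<open>digraph_iso\<close>,
  reached through the coercion \<^const>\<open>with_proj\<close>.
\<close>

definition order_divisor_graph :: "('a, 'm) monoid_scheme \<Rightarrow> 'a pair_pre_digraph" where
  "order_divisor_graph G =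
     \<lparr>pverts = carrier G,
      parcs = {(a, b). a \<in> carrier G \<and> b \<in> carrier G \<and> a \<noteq> b \<and>
                 group.ord G a \<noteq> group.ord G b \<and>
                 (group.ord G a dvd group.ord G b \<or> group.ord G b dvd group.ord G a)}\<rparr>"

text \<open>The graph $mK_1$.\<close>

definition edgeless_graph :: "nat \<Rightarrow> nat pair_pre_digraph" where
  "edgeless_graph m = \<lparr>pverts = {..<m}, parcs = {}\<rparr>"

definition graph_union ::
  "'a pair_pre_digraph \<Rightarrow> 'a pair_pre_digraph \<Rightarrow> 'a pair_pre_digraph"  (infixl \<open>\<union>\<^sub>G\<close> 65) where
  "A \<union>\<^sub>G B = \<lparr>pverts = pverts A \<union> pverts B, parcs = parcs A \<union> parcs B\<rparr>"

text \<open>The join is meaningful only for graphs with disjoint vertex sets.\<close>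

definition graph_join ::
  "'a pair_pre_digraph \<Rightarrow> 'a pair_pre_digraph \<Rightarrow> 'a pair_pre_digraph"  (infixl \<open>\<diamondop>\<close> 70) where
  "A \<diamondop> B =
     \<lparr>pverts = pverts A \<union> pverts B,
      parcs = parcs A \<union> parcs B \<union> pverts A \<times> pverts B \<union> pverts B \<times> pverts A\<rparr>"

definition pairwise_vertex_disjoint :: "'a pair_pre_digraph list \<Rightarrow> bool" where
  "pairwise_vertex_disjoint Gs \<longleftrightarrow>
     (\<forall>i < length Gs. \<forall>j < length Gs. i \<noteq> j \<longrightarrow> pverts (Gs ! i) \<inter> pverts (Gs ! j) = {})"

lemma pair_graph_order_divisor_graph:
  assumes "finite (carrier G)"
  shows "pair_graph (order_divisor_graph G)"
proof
  have "parcs (order_divisor_graph G) \<subseteq> carrier G \<times> carrier G"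
    by (auto simp: order_divisor_graph_def)
  then show "finite (parcs (order_divisor_graph G))"
    using assms finite_subset by blast
qed (use assms in \<open>auto simp: order_divisor_graph_def symmetric_def intro!: symI\<close>)

lemma with_proj_graph_union:
  "with_proj (A \<union>\<^sub>G B) = Digraph_Component.union (with_proj A) (with_proj B)"
  by (simp add: graph_union_def Digraph_Component.union_def with_proj_def)

lemma pair_graph_graph_union:
  assumes "pair_graph A" "pair_graph B"
  shows "pair_graph (A \<union>\<^sub>G B)"
proof -
  interpret A: pair_graph A by fact
  interpret B: pair_graph B by fact
  show ?thesis
  proof
    show "symmetric (with_proj (A \<union>\<^sub>G B))"
      using A.sym_arcs B.sym_arcs by (auto simp: symmetric_def graph_union_def sym_def)
  qed (use A.pair_no_loops B.pair_no_loops in \<open>auto simp: graph_union_def dest: A.in_arcsD1 A.in_arcsD2 B.in_arcsD1 B.in_arcsD2\<close>)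
qed

lemma pair_graph_graph_join:
  assumes "pair_graph A" "pair_graph B" "pverts A \<inter> pverts B = {}"
  shows "pair_graph (A \<diamondop> B)"
proof -
  interpret A: pair_graph A by fact
  interpret B: pair_graph B by fact
  show ?thesis
  proof
    show "symmetric (with_proj (A \<diamondop> B))"
      using A.sym_arcs B.sym_arcs by (auto simp: symmetric_def graph_join_def sym_def)
  qed (use assms(3) A.pair_no_loops B.pair_no_loops in \<open>auto simp: graph_join_def dest: A.in_arcsD1 A.in_arcsD2 B.in_arcsD1 B.in_arcsD2\<close>)
qed

text \<open>Disjoint copies of prescribed edgeless graphs always exist.\<close>

lemma disjoint_edgeless_graphs_exist:
  fixes ms :: "nat list"
  shows "\<exists>Gs :: (nat \<times> nat) pair_pre_digraph list.
           list_all2 (\<lambda>G m. digraph_iso (with_proj G) (with_proj (edgeless_graph m))) Gs ms \<and> pairwise_vertex_disjoint Gs"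
proof -
  define copy :: "nat \<Rightarrow> (nat \<times> nat) pair_pre_digraph"
    where "copy i = \<lparr>pverts = {i} \<times> {..<ms ! i}, parcs = {}\<rparr>" for i
  have iso: "digraph_iso (copy i) (edgeless_graph (ms ! i))" for i
  proof -
    define f :: "(nat \<times> nat, (nat \<times> nat) \<times> nat \<times> nat, nat, nat \<times> nat) digraph_isomorphism"
      where "f = \<lparr>iso_verts = snd, iso_arcs = (\<lambda>_. (0, 0)), iso_head = snd, iso_tail = fst\<rparr>"
    have "pre_digraph.digraph_isomorphism (with_proj (copy i)) f"
      by (auto simp: pre_digraph.digraph_isomorphism_def f_def copy_def with_proj_def
            wf_digraph_def inj_on_def)
    moreover have "with_proj (edgeless_graph (ms ! i)) = app_iso f (with_proj (copy i))"
      by (auto simp: app_iso_def f_def copy_def with_proj_def edgeless_graph_def)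
    ultimately show ?thesis
      unfolding digraph_iso_def by blast
  qed
  have "list_all2 (\<lambda>G m. digraph_iso (with_proj G) (with_proj (edgeless_graph m))) (map copy [0..<length ms]) ms"
    using iso by (auto simp: list_all2_conv_all_nth)
  moreover have "pairwise_vertex_disjoint (map copy [0..<length ms])"
    by (auto simp: pairwise_vertex_disjoint_def copy_def)
  ultimately show ?thesis
    by blast
qed

end

theory Submission
  imports Defs "HOL-Computational_Algebra.Squarefree" "HOL-Number_Theory.Totient"
begin

text \<open>
  A cyclic group of order \<open>n\<close> has \<open>totient d\<close> elements of each order \<open>d\<close> dividing \<open>n\<close>. For
  squarefree \<open>n\<close>, sending an element to the set of primes dividing its order turns proper
  divisibility of orders into strict inclusion, so the order divisor graph is the comparability
  graph of the subsets of the primes of \<open>n\<close>, with the subset \<open>S\<close> blown up to an independent set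
  of size \<open>\<Prod>p\<in>S. p - 1\<close>. For three primes this is the graph of the theorem.
\<close>

section \<open>Isomorphisms of pair digraphs\<close>

lemma digraph_iso_edgeless_graphD:
  assumes "digraph_iso (with_proj G) (with_proj (edgeless_graph m))"
  shows "parcs G = {}" and "card (pverts G) = m"
proof -
  obtain f where f: "pre_digraph.digraph_isomorphism (with_proj G) f"
    and eq: "with_proj (edgeless_graph m) = app_iso f (with_proj G)"
    using assms unfolding digraph_iso_def by blast
  have "{..<m} = iso_verts f ` pverts G" "{} = iso_arcs f ` parcs G"
    using arg_cong[OF eq, of verts] arg_cong[OF eq, of arcs] by (simp_all add: edgeless_graph_def)
  moreover have "inj_on (iso_verts f) (pverts G)"
    using pre_digraph.digraph_isomorphism_inj_on_verts[OF f] by simp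
  ultimately show "parcs G = {}" "card (pverts G) = m"
    by (auto dest!: card_image) (metis card_lessThan)
qed

text \<open>Arcs are pairs of vertices, so a vertex bijection already determines the arc
  map.\<close>

lemma digraph_iso_pairI:
  assumes A: "parcs A \<subseteq> pverts A \<times> pverts A" and B: "parcs B \<subseteq> pverts B \<times> pverts B"
    and f: "bij_betw f (pverts A) (pverts B)"
    and arcs: "\<And>x y. x \<in> pverts A \<Longrightarrow> y \<in> pverts A \<Longrightarrow> (x, y) \<in> parcs A \<longleftrightarrow> (f x, f y) \<in> parcs B"
  shows "digraph_iso (with_proj A) (with_proj B)"
proof -
  \<comment> \<open>\<open>iso_tail\<close> and \<open>iso_head\<close> become the incidence maps of
    the image, so they must be the projections that \<open>with_proj B\<close> carries.\<close>
  define h where "h = \<lparr>iso_verts = f, iso_arcs = map_prod f f, iso_head = snd, iso_tail = fst\<rparr>"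
  have inj: "inj_on f (pverts A)" and im: "f ` pverts A = pverts B"
    using f by (auto simp: bij_betw_def)
  have "inj_on (map_prod f f) (parcs A)"
    using map_prod_inj_on[OF inj inj] A inj_on_subset by blast
  moreover have "wf_digraph (with_proj A)"
    using A by (auto simp: wf_digraph_def)
  ultimately have "pre_digraph.digraph_isomorphism (with_proj A) h"
    using inj by (auto simp: pre_digraph.digraph_isomorphism_def h_def)
  moreover have "parcs B = map_prod f f ` parcs A"
  proof
    show "map_prod f f ` parcs A \<subseteq> parcs B"
      using A arcs by auto
    show "parcs B \<subseteq> map_prod f f ` parcs A"
    proof
      fix e assume e: "e \<in> parcs B"
      then obtain x y where xy: "x \<in> pverts A" "y \<in> pverts A" "e = (f x, f y)"
        using B im by blast
      then have "(x, y) \<in> parcs A" using arcs e by blast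
      then show "e \<in> map_prod f f ` parcs A" using xy(3) by force
    qed
  qed
  then have "with_proj B = app_iso h (with_proj A)"
    using im by (simp add: app_iso_def h_def with_proj_def)
  ultimately show ?thesis
    unfolding digraph_iso_def by blast
qed

text \<open>Fibres of equal size are in bijection, and these bijections glue because distinct labels
  have disjoint fibres. Finiteness makes equal \<open>card\<close> mean equal size.\<close>

lemma bij_betw_fibrewise:
  assumes "finite A" "finite B"
    and card: "\<And>s. card {x \<in> A. c x = s} = card {y \<in> B. l y = s}"
  obtains f where "bij_betw f A B" and "\<And>x. x \<in> A \<Longrightarrow> l (f x) = c x"
proof -
  have "\<exists>g. bij_betw g {x \<in> A. c x = s} {y \<in> B. l y = s}" for s
    using assms by (intro finite_same_card_bij) auto
  then obtain g where g: "\<And>s. bij_betw (g s) {x \<in> A. c x = s} {y \<in> B. l y = s}"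
    by metis
  define f where "f x = g (c x) x" for x
  have f: "f x \<in> B" "l (f x) = c x" if "x \<in> A" for x
    using bij_betwE[OF g[of "c x"]] that by (auto simp: f_def)
  have "inj_on f A"
  proof (rule inj_onI)
    fix x y assume xy: "x \<in> A" "y \<in> A" "f x = f y"
    then have "c x = c y" using f by metis
    then show "x = y"
      using xy bij_betw_imp_inj_on[OF g[of "c x"]] by (auto simp: f_def dest: inj_onD)
  qed
  moreover have "y \<in> f ` A" if "y \<in> B" for y
  proof -
    have "y \<in> g (l y) ` {x \<in> A. c x = l y}"
      using bij_betw_imp_surj_on[OF g[of "l y"]] that by blast
    then show ?thesis by (force simp: f_def)
  qed
  ultimately have "bij_betw f A B"
    using f(1) by (auto simp: bij_betw_def)
  then show thesis using that f(2) by blast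
qed

section \<open>Elements of given order in a cyclic group\<close>

text \<open>For a generator \<open>g\<close>, the power \<open>g [^] k\<close> has order
  \<open>n div gcd k n\<close>, so the count is that of the \<open>k\<close> with
  \<open>gcd k n = n div d\<close>.\<close>

lemma (in group) card_ord_eq_totient:
  assumes cyc: "cyclic_group G" and fin: "finite (carrier G)" and d: "d dvd order G"
  shows "card {x \<in> carrier G. ord x = d} = totient d"
proof -
  define n where "n = order G"
  have n: "n > 0" using fin by (simp add: n_def order_gt_0_iff_finite)
  obtain g where g: "g \<in> carrier G" "subgroup_generated G {g} = G"
    using cyc by (auto simp: cyclic_group_def)
  have ord_g: "ord g = n"
    using cyclic_order_is_ord[OF g(1)] g(2) by (simp add: n_def)
  \<comment> \<open>The exponents run from 1 to \<open>n\<close>, the range in which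
    \<open>card_gcd_eq_totient\<close> counts.\<close>
  have inj: "inj_on (\<lambda>k. g [^] k) {0<..n}"
    using ord_inj'[OF g(1)] by (rule inj_on_subset) (auto simp: ord_g)
  have im: "(\<lambda>k. g [^] k) ` {0<..n} = carrier G"
    using fin g(1) card_image[OF inj] by (intro card_subset_eq) (auto simp: n_def order_def)
  have ord: "ord (g [^] k) = n div gcd k n" if "k \<in> {0<..n}" for k
    using that ord_pow_gen[OF g(1), of k] by (simp add: ord_g gcd.commute)
  have *: "n div gcd k n = d \<longleftrightarrow> gcd k n = n div d" if "k \<in> {0<..n}" for k
  proof -
    obtain m where m: "n = d * m" using d by (auto simp: n_def)
    obtain h where h: "n = gcd k n * h" using gcd_dvd2 by blast
    have "n div gcd k n = h" "n div d = m"
      using n m h by (metis nonzero_mult_div_cancel_left mult_eq_0_iff nat_neq_iff)+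
    then show ?thesis
      using n m h by (metis mult.commute mult_cancel_left mult_eq_0_iff nat_neq_iff)
  qed
  have "{x \<in> carrier G. ord x = d} = (\<lambda>k. g [^] k) ` {k \<in> {0<..n}. gcd k n = n div d}"
    unfolding im[symmetric] using ord * by fastforce
  then have "card {x \<in> carrier G. ord x = d} = card {k \<in> {0<..n}. gcd k n = n div d}"
    using inj by (auto intro!: card_image inj_on_subset[OF inj])
  also have "\<dots> = totient (n div (n div d))"
    using d n by (intro card_gcd_eq_totient) (auto simp: n_def)
  also have "n div (n div d) = d"
    using d n by (auto simp: n_def elim!: dvdE)
  finally show ?thesis .
qed

section \<open>Squarefree numbers as sets of primes\<close>

lemma prod_primes_nonzero:
  fixes S :: "nat set"
  assumes "\<And>p. p \<in> S \<Longrightarrow> prime p"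
  shows "\<Prod>S \<noteq> 0"
  using assms prime_gt_0_nat by (intro prod_pos[THEN gr_implies_not0]) auto

text \<open>By unique factorization a set of primes is recovered from its product. With
  \<open>dvd_prod_primes\<close>, the subsets of \<open>P\<close> correspond to the divisors of
  \<open>\<Prod>P\<close>.\<close>

lemma prime_factors_prod_primes:
  fixes S :: "nat set"
  assumes "finite S" "\<And>p. p \<in> S \<Longrightarrow> prime p"
  shows "prime_factors (\<Prod>S) = S"
  using assms prime_factorization_prod_mset_primes[of "mset_set S"]
  by (simp add: prod_unfold_prod_mset)

text \<open>A product of distinct primes is squarefree, hence so is its divisor \<open>d\<close>,
  and every prime of \<open>d\<close> has multiplicity 1.\<close>

lemma dvd_prod_primes:
  fixes P :: "nat set"
  assumes P: "finite P" "\<And>p. p \<in> P \<Longrightarrow> prime p" and d: "d dvd \<Prod>P"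
  shows "d = \<Prod>(prime_factors d)" and "prime_factors d \<subseteq> P"
proof -
  have nz: "\<Prod>P \<noteq> 0" using P(2) by (rule prod_primes_nonzero)
  then have d0: "d \<noteq> 0" using d by auto
  show sub: "prime_factors d \<subseteq> P"
    using dvd_prime_factors[OF nz d] prime_factors_prod_primes[OF P] by simp
  have "squarefree (\<Prod>P)"
    using P by (intro squarefree_prod_coprime) (auto simp: primes_coprime squarefree_prime)
  then have "squarefree d" using d squarefree_mono by blast
  then have "multiplicity p d = 1" if "p \<in> prime_factors d" for p
    using that d0 squarefree_factorial_semiring'[OF d0] by blast
  then show "d = \<Prod>(prime_factors d)"
    using prime_factorization_nat[of d] d0 by simp
qed

lemma totient_prod_primes:
  fixes S :: "nat set"
  assumes "\<And>p. p \<in> S \<Longrightarrow> prime p"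
  shows "totient (\<Prod>S) = (\<Prod>p\<in>S. p - 1)"
proof -
  have "totient (\<Prod>S) = (\<Prod>p\<in>S. totient p)"
    using assms totient_prod_coprime[where f = "\<lambda>p. p" and A = S]
    by (auto simp: primes_coprime pairwise_def)
  also have "\<dots> = (\<Prod>p\<in>S. p - 1)"
    using assms by (intro prod.cong) (auto simp: totient_prime)
  finally show ?thesis .
qed

section \<open>Order divisor graphs of cyclic groups of squarefree order\<close>

text \<open>The labelling \<open>l\<close> abstracts from how \<open>B\<close> is assembled: fibre
  sizes yield a bijection that preserves labels, and labels determine adjacency on both
  sides.\<close>

lemma order_divisor_graph_cyclic_squarefree_iso:
  fixes P :: "nat set" and l :: "'b \<Rightarrow> nat set" and B :: "'b pair_pre_digraph"
  assumes H: "group H" "cyclic_group H" "order H = \<Prod>P"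
    and P: "finite P" "\<And>p. p \<in> P \<Longrightarrow> prime p"
    and l: "\<And>v. v \<in> pverts B \<Longrightarrow> l v \<subseteq> P"
    and card: "\<And>S. S \<subseteq> P \<Longrightarrow> card {v \<in> pverts B. l v = S} = (\<Prod>p\<in>S. p - 1)"
    and arcs: "parcs B = {(u, v). u \<in> pverts B \<and> v \<in> pverts B \<and> (l u \<subset> l v \<or> l v \<subset> l u)}"
  shows "digraph_iso (with_proj (order_divisor_graph H)) (with_proj B)"
proof -
  interpret group H by fact
  have nz: "\<Prod>P \<noteq> 0" using P(2) by (rule prod_primes_nonzero)
  then have fin: "finite (carrier H)"
    using H(3) order_gt_0_iff_finite by simp
  define c where "c x = prime_factors (ord x)" for x
  have ord_dvd: "ord x dvd \<Prod>P" if "x \<in> carrier H" for x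
    using ord_dvd_group_order[OF that] H(3) by simp
  have cP: "c x \<subseteq> P" and ord_c: "ord x = \<Prod>(c x)" if "x \<in> carrier H" for x
    unfolding c_def using dvd_prod_primes[OF P ord_dvd[OF that]] by auto
  have prime_S: "prime p" if "p \<in> S" "S \<subseteq> P" for p S
    using that P(2) by blast
  have c_iff: "c x = S \<longleftrightarrow> ord x = \<Prod>S" if "x \<in> carrier H" "S \<subseteq> P" for x S
    using ord_c[OF that(1)] prime_factors_prod_primes[of S] finite_subset[OF that(2) P(1)]
      prime_S that(2) unfolding c_def by metis
  have card_c: "card {x \<in> carrier H. c x = S} = (\<Prod>p\<in>S. p - 1)" if "S \<subseteq> P" for S
  proof -
    have "{x \<in> carrier H. c x = S} = {x \<in> carrier H. ord x = \<Prod>S}"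
      using c_iff that by blast
    moreover have "\<Prod>S dvd order H"
      unfolding H(3) using P(1) that by (rule prod_dvd_prod_subset)
    ultimately show ?thesis
      using card_ord_eq_totient[OF H(2) fin] totient_prod_primes[of S] prime_S that by simp
  qed
  \<comment> \<open>An infinite set has \<open>card\<close> 0, whereas each prescribed fibre size is
    a product of positive numbers \<open>p - 1\<close>; so each of the finitely many fibres is
    finite.\<close>
  have finB: "finite (pverts B)"
  proof -
    have "finite {v \<in> pverts B. l v = S}" if "S \<in> Pow P" for S
    proof (rule card_ge_0_finite)
      have "(\<Prod>p\<in>S. p - 1) > 0"
        using prime_S[OF _ that[unfolded Pow_iff]] by (intro prod_pos) (simp add: prime_gt_Suc_0_nat)
      then show "card {v \<in> pverts B. l v = S} > 0" using card that by simp
    qed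
    then have "finite (\<Union>S\<in>Pow P. {v \<in> pverts B. l v = S})"
      using P(1) by blast
    then show ?thesis
      by (rule finite_subset[rotated]) (use l in auto)
  qed
  \<comment> \<open>Outside the subsets of \<open>P\<close> both fibres are empty.\<close>
  have same_card: "card {x \<in> carrier H. c x = S} = card {v \<in> pverts B. l v = S}" for S
  proof (cases "S \<subseteq> P")
    case False
    then have "{x \<in> carrier H. c x = S} = {}" "{v \<in> pverts B. l v = S} = {}"
      using cP l by blast+
    then show ?thesis by (simp only: card.empty)
  qed (use card card_c in simp)
  obtain f where f: "bij_betw f (carrier H) (pverts B)" "\<And>x. x \<in> carrier H \<Longrightarrow> l (f x) = c x"
    by (rule bij_betw_fibrewise[OF fin finB same_card]) blast
  \<comment> \<open>Left to right, \<open>ord y\<close> is nonzero as a divisor of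
    \<open>\<Prod>P\<close>, so divisibility passes to prime factors; right to left, a subproduct
    divides the product.\<close>
  have dvd_iff: "ord x dvd ord y \<longleftrightarrow> c x \<subseteq> c y" if "x \<in> carrier H" "y \<in> carrier H" for x y
  proof
    assume "ord x dvd ord y"
    then show "c x \<subseteq> c y"
      using ord_dvd[OF that(2)] nz unfolding c_def by (metis dvd_0_left dvd_prime_factors)
  next
    assume "c x \<subseteq> c y"
    then show "ord x dvd ord y"
      using ord_c that by (metis prod_dvd_prod_subset c_def finite_set_mset)
  qed
  have eq_iff: "ord x = ord y \<longleftrightarrow> c x = c y" if "x \<in> carrier H" "y \<in> carrier H" for x y
    using ord_c that by (metis c_def)
  show ?thesis
  proof (rule digraph_iso_pairI[where f = f])
    show "bij_betw f (pverts (order_divisor_graph H)) (pverts B)"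
      using f(1) by (simp add: order_divisor_graph_def)
    fix x y
    assume "x \<in> pverts (order_divisor_graph H)" "y \<in> pverts (order_divisor_graph H)"
    then have xy: "x \<in> carrier H" "y \<in> carrier H"
      by (simp_all add: order_divisor_graph_def)
    then have "f x \<in> pverts B" "f y \<in> pverts B"
      using bij_betwE[OF f(1)] by auto
    then show "(x, y) \<in> parcs (order_divisor_graph H) \<longleftrightarrow> (f x, f y) \<in> parcs B"
      using xy by (auto simp: order_divisor_graph_def arcs f(2) dvd_iff eq_iff)
  qed (auto simp: order_divisor_graph_def arcs)
qed

section \<open>Three primes\<close>

theorem theorem5:
  fixes H :: "'a monoid" and p1 p2 p3 :: nat
    and G1 G2 G3 G12 G23 G13 G123 K :: "'b pair_pre_digraph"
  assumes "group H" and "cyclic_group H" and "order H = p1 * p2 * p3"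
    and "prime p1" and "prime p2" and "prime p3"
    and "p1 \<noteq> p2" and "p2 \<noteq> p3" and "p1 \<noteq> p3"
    and "digraph_iso G1 (edgeless_graph (p1 - 1))"
    and "digraph_iso G2 (edgeless_graph (p2 - 1))"
    and "digraph_iso G3 (edgeless_graph (p3 - 1))"
    and "digraph_iso G12 (edgeless_graph ((p1 - 1) * (p2 - 1)))"
    and "digraph_iso G23 (edgeless_graph ((p2 - 1) * (p3 - 1)))"
    and "digraph_iso G13 (edgeless_graph ((p1 - 1) * (p3 - 1)))"
    and "digraph_iso G123 (edgeless_graph ((p1 - 1) * (p2 - 1) * (p3 - 1)))"
    and "digraph_iso K (edgeless_graph 1)"
    and "pairwise_vertex_disjoint [G1, G2, G3, G12, G23, G13, G123, K]"
  shows "digraph_iso (order_divisor_graph H)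
    (((G1 \<diamondop> G12 \<union>\<^sub>G G12 \<diamondop> G2 \<union>\<^sub>G G2 \<diamondop> G23 \<union>\<^sub>G G23 \<diamondop> G3 \<union>\<^sub>G G3 \<diamondop> G13 \<union>\<^sub>G G13 \<diamondop> G1)
        \<diamondop> G123) \<diamondop> K)"
proof -
  note iso = assms(10-17)
  note no_arcs = iso[THEN digraph_iso_edgeless_graphD(1)]
    and card_verts = iso[THEN digraph_iso_edgeless_graphD(2)]
  \<comment> \<open>The two lists are parallel: index \<open>i\<close> pairs a constituent graph
    with its set of primes. \<open>K\<close> gets the empty set, the label of the identity.\<close>
  let ?Gs = "[G1, G2, G3, G12, G23, G13, G123, K]"
  let ?Ss = "[{p1}, {p2}, {p3}, {p1, p2}, {p2, p3}, {p1, p3}, {p1, p2, p3}, {}]"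
  define l where "l v = ?Ss ! (THE i. i < 8 \<and> v \<in> pverts (?Gs ! i))" for v
  \<comment> \<open>Vertex disjointness makes the index in the definite description unique.\<close>
  have l_nth: "l v = ?Ss ! i" if "i < 8" "v \<in> pverts (?Gs ! i)" for i v
  proof -
    have "(THE i. i < 8 \<and> v \<in> pverts (?Gs ! i)) = i"
    proof (rule the_equality)
      fix j assume "j < 8 \<and> v \<in> pverts (?Gs ! j)"
      moreover have "length ?Gs = 8" by simp
      ultimately show "j = i"
        using assms(18) that unfolding pairwise_vertex_disjoint_def \<open>length ?Gs = 8\<close> by blast
    qed (use that in blast)
    then show ?thesis by (simp only: l_def)
  qed
  have l:
    "v \<in> pverts G1 \<Longrightarrow> l v = {p1}" "v \<in> pverts G2 \<Longrightarrow> l v = {p2}"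
    "v \<in> pverts G3 \<Longrightarrow> l v = {p3}" "v \<in> pverts G12 \<Longrightarrow> l v = {p1, p2}"
    "v \<in> pverts G23 \<Longrightarrow> l v = {p2, p3}" "v \<in> pverts G13 \<Longrightarrow> l v = {p1, p3}"
    "v \<in> pverts G123 \<Longrightarrow> l v = {p1, p2, p3}" "v \<in> pverts K \<Longrightarrow> l v = {}" for v
    using l_nth[of 0 v] l_nth[of 1 v] l_nth[of 2 v] l_nth[of 3 v] l_nth[of 4 v] l_nth[of 5 v]
      l_nth[of 6 v] l_nth[of 7 v] by simp_all
  let ?B = "((G1 \<diamondop> G12 \<union>\<^sub>G G12 \<diamondop> G2 \<union>\<^sub>G G2 \<diamondop> G23 \<union>\<^sub>G G23 \<diamondop> G3 \<union>\<^sub>G G3 \<diamondop> G13 \<union>\<^sub>G G13 \<diamondop> G1)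
        \<diamondop> G123) \<diamondop> K"
  have verts: "v \<in> pverts ?B \<longleftrightarrow> v \<in> pverts G1 \<or> v \<in> pverts G2 \<or> v \<in> pverts G3 \<or>
      v \<in> pverts G12 \<or> v \<in> pverts G23 \<or> v \<in> pverts G13 \<or> v \<in> pverts G123 \<or> v \<in> pverts K" for v
    by (auto simp: graph_join_def graph_union_def)
  have verts_nth: "v \<in> pverts ?B \<longleftrightarrow> (\<exists>i<8. v \<in> pverts (?Gs ! i))" for v
  proof -
    have "v \<in> pverts ?B \<longleftrightarrow> (\<exists>G\<in>set ?Gs. v \<in> pverts G)"
      by (auto simp: verts)
    moreover have "length ?Gs = 8" by simp
    ultimately show ?thesis by (metis in_set_conv_nth)
  qed
  \<comment> \<open>The primes being distinct, so are the eight labels; hence no two constituents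
    share a fibre.\<close>
  have fibre_nth: "{v \<in> pverts ?B. l v = ?Ss ! i} = pverts (?Gs ! i)" if "i < 8" for i
  proof -
    have "distinct ?Ss" "length ?Ss = 8" using assms(7-9) by auto
    then have "j = i" if "j < 8" "?Ss ! j = ?Ss ! i" for j
      using that \<open>i < 8\<close> by (metis nth_eq_iff_index_eq)
    then show ?thesis
      using \<open>i < 8\<close> l_nth unfolding verts_nth by blast
  qed
  have fibre:
    "{v \<in> pverts ?B. l v = {p1}} = pverts G1" "{v \<in> pverts ?B. l v = {p2}} = pverts G2"
    "{v \<in> pverts ?B. l v = {p3}} = pverts G3" "{v \<in> pverts ?B. l v = {p1, p2}} = pverts G12"
    "{v \<in> pverts ?B. l v = {p2, p3}} = pverts G23" "{v \<in> pverts ?B. l v = {p1, p3}} = pverts G13"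
    "{v \<in> pverts ?B. l v = {p1, p2, p3}} = pverts G123" "{v \<in> pverts ?B. l v = {}} = pverts K"
    using fibre_nth[of 0] fibre_nth[of 1] fibre_nth[of 2] fibre_nth[of 3] fibre_nth[of 4]
      fibre_nth[of 5] fibre_nth[of 6] fibre_nth[of 7] by simp_all
  show ?thesis
  proof (rule order_divisor_graph_cyclic_squarefree_iso[where P = "{p1, p2, p3}" and l = l])
    show "order H = \<Prod>{p1, p2, p3}"
      using assms by (simp add: mult.assoc)
    show "l v \<subseteq> {p1, p2, p3}" if "v \<in> pverts ?B" for v
      using that unfolding verts by (elim disjE; simp add: l)
    show "card {v \<in> pverts ?B. l v = S} = (\<Prod>p\<in>S. p - 1)" if "S \<subseteq> {p1, p2, p3}" for S
    proof -
      have "S = {} \<or> S = {p1} \<or> S = {p2} \<or> S = {p3} \<or> S = {p1, p2} \<or> S = {p2, p3} \<or> S = {p1, p3}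
          \<or> S = {p1, p2, p3}"
        using that[folded Pow_iff] by (simp add: Pow_insert) argo
      then show ?thesis
        \<comment> \<open>The empty product 1 is the size of \<open>K\<close>.\<close>
        by (elim disjE; hypsubst; simp only: fibre; simp add: card_verts assms(7-9))
    qed
    \<comment> \<open>The hexagon of joins is the inclusion of singletons in pairs;
      \<open>G123\<close> and \<open>K\<close> are joined to the rest because the full set contains,
      and the empty set lies in, every other label.\<close>
    show "parcs ?B = {(u, v). u \<in> pverts ?B \<and> v \<in> pverts ?B \<and> (l u \<subset> l v \<or> l v \<subset> l u)}"
      (is "_ = ?R")
    proof (intro subset_antisym subrelI)
      fix u v assume "(u, v) \<in> parcs ?B"
      then show "(u, v) \<in> ?R"
        \<comment> \<open>The constituents are edgeless, so every arc comes from a join.\<close>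
        using assms(7-9) by (auto simp: graph_join_def graph_union_def no_arcs l subset_not_subset_eq)
    next
      fix u v assume "(u, v) \<in> ?R"
      then have "u \<in> pverts ?B" "v \<in> pverts ?B" and "l u \<subset> l v \<or> l v \<subset> l u"
        by simp_all
      then show "(u, v) \<in> parcs ?B"
        \<comment> \<open>All pairs of constituents are examined; incomparable labels contradict the
          assumed strict inclusion.\<close>
        using assms(7-9) unfolding verts
        by (elim disjE; simp add: l subset_not_subset_eq)
          (simp_all add: graph_join_def graph_union_def)
    qed
  qed (use assms in auto)
qed

end
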